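(* There are infinitely many sets $B$ of the form $B=\{ag^k: k\in\mathbb{N}\}$ with $a\in\mathbb{N}$ and $g\in\mathbb{N}\setminus\{1\}$ (infinite geometric progressions) having the following property: for every real number $\alpha\in(0,1]$ there exists an additive complement $A\subset\mathbb{N}$ of $B$ such that $A$ can be written as a union of disjoint infinite arithmetic progressions and $d(A)=\alpha$.
   Context: $\mathbb{N}$ denotes the set of positive integers and $\mathbb{N}_0$ the set of nonnegative integers. For $A,B\subset\mathbb{N}$, $A+B=\{x+y: x\in A,\ y\in B\}$. A set $A\subset\mathbb{N}$ is an additive complement of $B\subset\mathbb{N}$ if $\mathbb{N}\setminus(A+B)$ is finite. An infinite arithmetic progression is a set of the form $\{x+id: i\in\mathbb{N}_0\}$ with $x,d\in\mathbb{N}$. A nonempty set $A\subset\mathbb{N}$ is a union of disjoint infinite arithmetic progressions if it is the union of some (finite or infinite) family of pairwise disjoint infinite arithmetic progressions; the common differences may vary within the family. For $A\subset\mathbb{N}$, the upper and lower asymptotic densities are $\overline{d}(A)=\limsup_{n\to\infty}\frac{|A\cap[1,n]|}{n}$ and $\underline{d}(A)=\liminf_{n\to\infty}\frac{|A\cap[1,n]|}{n}$; if they are equal, the density $d(A)$ is said to exist and is their common value. The assertion $d(A)=\alpha$ means that the density exists and equals $\alpha$. *)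

theory Defs
  imports
    "HOL-Library.Extended_Real"
    "HOL-Library.Set_Algebras"
    "HOL-Library.Disjoint_Sets"
begin

text \<open>
  Positive integers are modelled by \<open>nat\<close> with explicit positivity constraints; a subset of the
  positive integers is an \<open>A :: nat set\<close> with \<open>A \<subseteq> {1..}\<close>.
\<close>

definition additive_complement :: "nat set \<Rightarrow> nat set \<Rightarrow> bool" where
  "additive_complement A B \<longleftrightarrow> A \<subseteq> {1..} \<and> B \<subseteq> {1..} \<and> finite ({1..} - (A + B))"

definition infinite_arith_prog :: "nat set \<Rightarrow> bool" where
  "infinite_arith_prog P \<longleftrightarrow> (\<exists>x d. 1 \<le> x \<and> 1 \<le> d \<and> P = {x + i * d | i. True})"

definition union_of_disjoint_arith_progs :: "nat set \<Rightarrow> bool" where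
  "union_of_disjoint_arith_progs A \<longleftrightarrow>
     A \<noteq> {} \<and> (\<exists>\<F>. (\<forall>P\<in>\<F>. infinite_arith_prog P) \<and> disjoint \<F> \<and> A = \<Union>\<F>)"

text \<open>The exponent starts at 1, so the first element is \<open>a * g\<close>.\<close>

definition infinite_geom_prog :: "nat set \<Rightarrow> bool" where
  "infinite_geom_prog B \<longleftrightarrow> (\<exists>a g. 1 \<le> a \<and> 2 \<le> g \<and> B = {a * g ^ k | k. 1 \<le> k})"

definition upper_asymp_density :: "nat set \<Rightarrow> ereal" where
  "upper_asymp_density A = limsup (\<lambda>n. ereal (real (card (A \<inter> {1..n})) / real n))"

definition lower_asymp_density :: "nat set \<Rightarrow> ereal" where
  "lower_asymp_density A = liminf (\<lambda>n. ereal (real (card (A \<inter> {1..n})) / real n))"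

definition has_asymp_density :: "nat set \<Rightarrow> real \<Rightarrow> bool" where
  "has_asymp_density A \<alpha> \<longleftrightarrow>
     lower_asymp_density A = ereal \<alpha> \<and> upper_asymp_density A = ereal \<alpha>"

end

theory Submission
  imports Defs "HOL-Number_Theory.Residue_Primitive_Roots"
begin

text \<open>
  The progressions are \<open>B = {2 ^ (j + k) | k. 1 \<le> k}\<close>, one for each \<open>j\<close>, and one family of sets
  \<open>A\<close> serves all of them.

  Since \<open>2\<close> is a primitive root modulo every power of \<open>3\<close>, the elements of \<open>B\<close> reach every residue
  class modulo \<open>3 ^ M\<close> that is prime to \<open>3\<close>. So if \<open>A\<close> contains the classes of \<open>0\<close> and \<open>1\<close> modulo
  some \<open>3 ^ M\<close>, then \<open>A + B\<close> contains every large \<open>n\<close>: one of \<open>n\<close> and \<open>n - 1\<close> is prime to \<open>3\<close>,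
  hence congruent to some \<open>2 ^ k\<close> in \<open>B\<close>, and the difference \<open>n - 2 ^ k\<close> is then in one of the two
  classes (\<open>additive_complement_of_powers_of_2\<close>). These two classes have density \<open>2 / 3 ^ M\<close>, as
  small as desired, and it remains to enlarge them to density exactly \<open>\<alpha>\<close>.

  The enlargement comes from the base-3 van der Corput sequence \<open>\<phi>\<close>, which mirrors the ternary digits
  of \<open>n\<close> at the radix point. Put \<open>A = {n \<ge> 1. \<phi> (n div 3) < \<alpha>}\<close>. Three properties of \<open>\<phi>\<close> give the
  three properties of \<open>A\<close>.

  \<^item> It is continuous from the 3-adic topology to the reals. So \<open>A\<close> is 3-adically open, which means
    that each of its elements lies in a class modulo some \<open>3 ^ N\<close> contained in \<open>A\<close>. Classes modulo
    powers of \<open>3\<close> are nested or disjoint, so the maximal ones inside \<open>A\<close> partition it into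
    progressions (\<open>union_of_disjoint_arith_progs_if_locally_residue_class\<close>).
  \<^item> It vanishes at \<open>0\<close>. Both \<open>0\<close> and \<open>1\<close> have quotient \<open>0\<close> by \<open>3\<close>, so continuity puts a class of
    each into \<open>A\<close>; producing two classes rather than one is why \<open>n div 3\<close> appears instead of \<open>n\<close>.
  \<^item> It is equidistributed in the unit interval, so \<open>A\<close> has density \<open>\<alpha>\<close> (\<open>discrepancy_bound\<close>).
\<close>

section \<open>Adically open sets are disjoint unions of progressions\<close>

definition residue_class :: "nat \<Rightarrow> nat \<Rightarrow> nat set" where
  "residue_class M n = {m. 1 \<le> m \<and> [m = n] (mod M)}"

lemma infinite_arith_prog_residue_class:
  assumes "M > 0"
  shows "infinite_arith_prog (residue_class M n)"
proof -
  \<comment> \<open>the least positive element: the residue \<open>0\<close> is represented by \<open>M\<close>\<close>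
  define x where "x = (if M dvd n then M else n mod M)"
  have x: "1 \<le> x" "x \<le> M" "[x = n] (mod M)"
    using assms by (auto simp: x_def cong_def mod_greater_zero_iff_not_dvd Suc_le_eq intro: less_imp_le)
  have "m \<in> residue_class M n \<longleftrightarrow> (\<exists>i. m = x + i * M)" for m
  proof
    assume "m \<in> residue_class M n"
    hence m: "1 \<le> m" "[m = x] (mod M)"
      using x(3) by (auto simp: residue_class_def intro: cong_trans cong_sym)
    have "x \<le> m"
    proof (rule ccontr)
      assume "\<not> x \<le> m"
      hence "m < M" "m < x" using x by auto
      moreover from this m x have "m = x mod M" by (auto simp: cong_def)
      ultimately show False using x(2) m(1) by (cases "x = M") auto
    qed
    with m(2) show "\<exists>i. m = x + i * M"
      by (metis add.commute cong_iff_lin_nat cong_le_nat cong_sym mult.commute)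
  next
    assume "\<exists>i. m = x + i * M"
    thus "m \<in> residue_class M n" using x by (auto simp: residue_class_def cong_def)
  qed
  hence "residue_class M n = {x + i * M | i. True}" by auto
  thus ?thesis using x(1) assms unfolding infinite_arith_prog_def by (metis Suc_leI One_nat_def)
qed

text \<open>
  The residue classes modulo powers of \<open>p\<close> form a laminar family. Each \<open>n \<in> A\<close> therefore has a
  largest class inside \<open>A\<close>, given by the least exponent, and two such largest classes that meet
  coincide.
\<close>

lemma union_of_disjoint_arith_progs_if_locally_residue_class:
  fixes p :: nat
  assumes "p > 0" "A \<noteq> {}" "A \<subseteq> {1..}"
    and ex: "\<And>n. n \<in> A \<Longrightarrow> \<exists>N. residue_class (p ^ N) n \<subseteq> A"
  shows "union_of_disjoint_arith_progs A"
proof -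
  define N where "N n = (LEAST N. residue_class (p ^ N) n \<subseteq> A)" for n
  define P where "P n = residue_class (p ^ N n) n" for n
  have P_sub: "P n \<subseteq> A" if "n \<in> A" for n
    unfolding P_def N_def using LeastI_ex[OF ex[OF that]] .
  have self: "n \<in> P n" if "n \<in> A" for n
    using that assms(3) by (auto simp: P_def residue_class_def)
  have meet: "P n = P n'"
    if nn': "n \<in> A" "n' \<in> A" "N n \<le> N n'" "P n \<inter> P n' \<noteq> {}" for n n'
  proof -
    obtain k where k: "[k = n] (mod p ^ N n)" "[k = n'] (mod p ^ N n')"
      using nn'(4) by (auto simp: P_def residue_class_def)
    have "[k = n'] (mod p ^ N n)"
      using k(2) nn'(3) by (rule cong_dvd_modulus_nat[OF _ le_imp_power_dvd])
    hence "[n = n'] (mod p ^ N n)" using k(1) cong_sym cong_trans by blast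
    hence eq: "residue_class (p ^ N n) n' = P n"
      by (auto simp: P_def residue_class_def intro: cong_trans cong_sym)
    \<comment> \<open>the coarser class already works for \<open>n'\<close>, so minimality of \<open>N n'\<close> forces equal exponents\<close>
    hence "N n' \<le> N n" unfolding N_def[of n'] using P_sub[OF nn'(1)] by (intro Least_le) simp
    thus ?thesis using eq nn'(3) by (simp add: P_def)
  qed
  have "disjoint (P ` A)"
  proof (rule disjointI)
    fix X Y assume "X \<in> P ` A" "Y \<in> P ` A" "X \<noteq> Y"
    then obtain n n' where "n \<in> A" "n' \<in> A" "X = P n" "Y = P n'" "P n \<noteq> P n'" by auto
    thus "X \<inter> Y = {}" using meet[of n n'] meet[of n' n] by (cases "N n \<le> N n'") auto
  qed
  moreover have "\<forall>X\<in>P ` A. infinite_arith_prog X"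
    using assms(1) by (auto simp: P_def intro: infinite_arith_prog_residue_class)
  moreover have "A = \<Union>(P ` A)" using P_sub self by blast
  ultimately show ?thesis unfolding union_of_disjoint_arith_progs_def using assms(2) by blast
qed

section \<open>The base-3 van der Corput sequence\<close>

text \<open>
  If \<open>n = \<Sum>i. d i * 3 ^ i\<close> with ternary digits \<open>d i\<close>, this is \<open>\<Sum>i. d i / 3 ^ (i + 1)\<close>.
\<close>

function radical_inverse :: "nat \<Rightarrow> real" where
  "radical_inverse n =
     (if n = 0 then 0 else (real (n mod 3) + radical_inverse (n div 3)) / 3)"
  by auto
termination by (relation "measure id") auto

declare radical_inverse.simps [simp del]

lemma radical_inverse_0 [simp]: "radical_inverse 0 = 0"
  by (simp add: radical_inverse.simps)

lemma radical_inverse_rec: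
  "radical_inverse n = (real (n mod 3) + radical_inverse (n div 3)) / 3"
  by (cases "n = 0") (simp_all add: radical_inverse.simps[of n])

lemma radical_inverse_bounds: "0 \<le> radical_inverse n" "radical_inverse n < 1"
proof (induction n rule: less_induct)
  case (less n)
  have "0 \<le> radical_inverse n \<and> radical_inverse n < 1"
  proof (cases "n = 0")
    case False
    have "real (n mod 3) \<le> real 2" by (subst of_nat_le_iff) simp
    thus ?thesis using less[of "n div 3"] False
      unfolding radical_inverse_rec[of n] by (simp add: field_simps)
  qed simp
  thus "0 \<le> radical_inverse n" "radical_inverse n < 1" by auto
qed

lemma cong_power_Suc_digits:
  fixes b :: nat
  assumes "[m = n] (mod b ^ Suc N)"
  shows "m mod b = n mod b" "[m div b = n div b] (mod b ^ N)"
proof -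
  show "m mod b = n mod b"
    using cong_dvd_modulus_nat[OF assms, of b] by (simp add: cong_def)
  have "(m mod (b * b ^ N)) div b = (n mod (b * b ^ N)) div b"
    using assms by (simp add: cong_def)
  thus "[m div b = n div b] (mod b ^ N)"
    by (cases "b = 0") (simp_all add: mod_mult2_eq cong_def)
qed

text \<open>
  The 3-adic continuity: the \<open>N\<close> lowest digits of an integer are the \<open>N\<close> leading ternary digits of
  its radical inverse.
\<close>

lemma radical_inverse_dist:
  assumes "[m = n] (mod 3 ^ N)"
  shows "\<bar>radical_inverse m - radical_inverse n\<bar> < 1 / 3 ^ N"
  using assms
proof (induction N arbitrary: m n)
  case 0
  show ?case using radical_inverse_bounds[of m] radical_inverse_bounds[of n] by simp
next
  case (Suc N)
  note digits = cong_power_Suc_digits[OF Suc.prems]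
  have "\<bar>radical_inverse m - radical_inverse n\<bar> =
      \<bar>radical_inverse (m div 3) - radical_inverse (n div 3)\<bar> / 3"
    unfolding radical_inverse_rec[of m] radical_inverse_rec[of n] digits(1)
    by (simp add: diff_divide_distrib [symmetric])
  also have "\<dots> < 1 / 3 ^ Suc N"
    using Suc.IH[OF digits(2)] by (simp add: field_simps)
  finally show ?case .
qed

section \<open>Equidistribution\<close>

definition count_below :: "(nat \<Rightarrow> bool) \<Rightarrow> nat \<Rightarrow> nat" where
  "count_below P K = card {n. n < K \<and> P n}"

lemma count_below_0 [simp]: "count_below P 0 = 0"
  by (simp add: count_below_def)

lemma count_below_Suc [simp]: "count_below P (Suc K) = count_below P K + of_bool (P K)"
proof -
  have "{n. n < Suc K \<and> P n} = (if P K then insert K else id) {n. n < K \<and> P n}"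
    by (auto simp: less_Suc_eq)
  thus ?thesis by (simp add: count_below_def)
qed

lemma count_below_True [simp]: "count_below (\<lambda>_. True) K = K"
  by (induction K) auto

lemma count_below_False [simp]: "count_below (\<lambda>_. False) K = 0"
  by (induction K) auto

lemma count_below_le: "count_below P K \<le> K"
  by (induction K) auto

lemma count_below_split3:
  "count_below P K =
     count_below (\<lambda>q. P (3 * q)) ((K + 2) div 3) +
     count_below (\<lambda>q. P (3 * q + 1)) ((K + 1) div 3) +
     count_below (\<lambda>q. P (3 * q + 2)) (K div 3)"
proof (induction K)
  case (Suc K)
  have "K mod 3 = 0 \<or> K mod 3 = 1 \<or> K mod 3 = 2" by linarith
  then consider q where "K = 3 * q" | q where "K = 3 * q + 1" | q where "K = 3 * q + 2"
    by (metis mod_div_decomp mult.commute add_0_right)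
  note q = this
  have "(3 * x + 2) div 3 = x" "Suc (Suc (3 * x)) div 3 = x" "Suc (3 * x) div 3 = x"
    "Suc (Suc (Suc (3 * x))) div 3 = Suc x" "Suc (Suc (Suc (Suc (3 * x)))) div 3 = Suc x"
    "Suc (Suc (Suc (Suc (Suc (3 * x))))) div 3 = Suc x" for x :: nat
    by presburger+
  note div = this
  from q show ?case by cases (use Suc in \<open>simp_all add: div\<close>)
qed simp

text \<open>
  Clipping \<open>\<alpha>\<close> to the unit interval makes the discrepancy meaningful for every real threshold, which
  the recursion below needs because it passes from \<open>\<alpha>\<close> to \<open>3 * \<alpha> - d\<close>.
\<close>

definition discrepancy :: "real \<Rightarrow> nat \<Rightarrow> real" where
  "discrepancy \<alpha> K =
     real (count_below (\<lambda>n. radical_inverse n < \<alpha>) K) - max 0 (min 1 \<alpha>) * real K"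

lemma discrepancy_nonpos: "\<alpha> \<le> 0 \<Longrightarrow> discrepancy \<alpha> K = 0"
proof -
  assume "\<alpha> \<le> 0"
  hence "\<not> radical_inverse n < \<alpha>" for n
    using radical_inverse_bounds(1)[of n] by linarith
  thus ?thesis using \<open>\<alpha> \<le> 0\<close> by (simp add: discrepancy_def)
qed

lemma discrepancy_ge_1: "1 \<le> \<alpha> \<Longrightarrow> discrepancy \<alpha> K = 0"
  using radical_inverse_bounds(2) by (simp add: discrepancy_def less_le_trans[of _ 1 \<alpha>])

lemma real_div_3_bounds: "real K / 3 - 2 / 3 \<le> real (K div 3)" "real (K div 3) \<le> real K / 3"
proof -
  have "real K = 3 * real (K div 3) + real (K mod 3)"
    by (metis mult_div_mod_eq of_nat_add of_nat_mult of_nat_numeral)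
  moreover have "real (K mod 3) \<le> real 2" by (subst of_nat_le_iff) simp
  ultimately show "real K / 3 - 2 / 3 \<le> real (K div 3)" "real (K div 3) \<le> real K / 3"
    by (simp_all add: field_simps)
qed

text \<open>
  For \<open>n = 3 * q + d\<close> with \<open>d < 3\<close>, the inequality \<open>radical_inverse n < \<alpha>\<close> means
  \<open>radical_inverse q < 3 * \<alpha> - d\<close>. Splitting the count by the last digit \<open>d\<close> therefore expresses the
  discrepancy through those at the three thresholds. The only loss is the rounding of \<open>K / 3\<close>, at most
  \<open>2 / 3\<close> for each digit.
\<close>

lemma discrepancy_rec:
  "\<bar>discrepancy \<alpha> K - (discrepancy (3 * \<alpha>) ((K + 2) div 3) +
      discrepancy (3 * \<alpha> - 1) ((K + 1) div 3) + discrepancy (3 * \<alpha> - 2) (K div 3))\<bar> \<le> 2"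
proof -
  define c :: "real \<Rightarrow> real" where "c x = max 0 (min 1 x)" for x
  define e where "e d = real ((K + d) div 3) - real K / 3" for d
  have digit: "radical_inverse (3 * q + d) < \<alpha> \<longleftrightarrow> radical_inverse q < 3 * \<alpha> - real d"
    if "d < 3" for q d
    using that unfolding radical_inverse_rec[of "3 * q + d"] by (simp add: field_simps)
  have c_sum: "c (3 * \<alpha>) + c (3 * \<alpha> - 1) + c (3 * \<alpha> - 2) = 3 * c \<alpha>"
    by (simp add: c_def max_def min_def)
  have c01: "0 \<le> c x" "c x \<le> 1" for x by (auto simp: c_def)
  have e: "\<bar>e d\<bar> \<le> 2 / 3" if "d \<le> 2" for d
    using real_div_3_bounds[of "K + d"] that by (auto simp: e_def abs_le_iff field_simps)
  have ce: "\<bar>c x * e d\<bar> \<le> 2 / 3" if "d \<le> 2" for x d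
    unfolding abs_mult using mult_mono[of "\<bar>c x\<bar>" 1 "\<bar>e d\<bar>" "2 / 3"] e[OF that] c01[of x] by simp
  have div: "real ((K + d) div 3) = e d + real K / 3" for d by (simp add: e_def)
  have div_0: "real (K div 3) = e 0 + real K / 3" by (simp add: e_def)
  have disc: "discrepancy x M = real (count_below (\<lambda>n. radical_inverse n < x) M) - c x * real M"
    for x M by (simp add: discrepancy_def c_def)
  have count: "count_below (\<lambda>n. radical_inverse n < \<alpha>) K =
      count_below (\<lambda>n. radical_inverse n < 3 * \<alpha>) ((K + 2) div 3) +
      count_below (\<lambda>n. radical_inverse n < 3 * \<alpha> - 1) ((K + 1) div 3) +
      count_below (\<lambda>n. radical_inverse n < 3 * \<alpha> - 2) (K div 3)"
    using digit[of 0] digit[of 1] digit[of 2] by (subst count_below_split3) simp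
  have "discrepancy \<alpha> K - (discrepancy (3 * \<alpha>) ((K + 2) div 3) +
      discrepancy (3 * \<alpha> - 1) ((K + 1) div 3) + discrepancy (3 * \<alpha> - 2) (K div 3)) =
      c (3 * \<alpha>) * e 2 + c (3 * \<alpha> - 1) * e 1 + c (3 * \<alpha> - 2) * e 0 +
      (c (3 * \<alpha>) + c (3 * \<alpha> - 1) + c (3 * \<alpha> - 2) - 3 * c \<alpha>) * (real K / 3)"
    unfolding disc count div div_0 by (simp add: algebra_simps)
  also have "\<dots> = c (3 * \<alpha>) * e 2 + c (3 * \<alpha> - 1) * e 1 + c (3 * \<alpha> - 2) * e 0"
    by (simp add: c_sum)
  also have "\<bar>\<dots>\<bar> \<le> 2"
    using ce[of 2 "3 * \<alpha>"] ce[of 1 "3 * \<alpha> - 1"] ce[of 0 "3 * \<alpha> - 2"] by linarith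
  finally show ?thesis .
qed

text \<open>
  At most one of the thresholds \<open>3 * \<alpha>\<close>, \<open>3 * \<alpha> - 1\<close>, \<open>3 * \<alpha> - 2\<close> lies strictly between \<open>0\<close> and \<open>1\<close>,
  and the discrepancy vanishes at the others. So the recursion does not branch: each step costs a
  bounded amount, absorbed by \<open>3\<close> together with the rounding of \<open>K / 3\<close>, and divides \<open>K\<close> by \<open>3\<close>.
\<close>

lemma discrepancy_bound: "\<bar>discrepancy \<alpha> K\<bar> \<le> 3 * real N + real K / 3 ^ N"
proof (induction N arbitrary: \<alpha> K)
  case 0
  have "0 \<le> max 0 (min 1 \<alpha>) * real K" "max 0 (min 1 \<alpha>) * real K \<le> 1 * real K"
    by (simp, intro mult_right_mono) auto
  moreover have "real (count_below (\<lambda>n. radical_inverse n < \<alpha>) K) \<le> real K"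
    using count_below_le by simp
  ultimately show ?case unfolding discrepancy_def by (simp only: power_0 of_nat_0)
next
  case (Suc N)
  have IH: "\<bar>discrepancy \<beta> ((K + d) div 3)\<bar> \<le> 3 * real N + real K / 3 ^ Suc N + 1"
    if "d \<le> 2" for \<beta> d
  proof -
    have "real ((K + d) div 3) \<le> real K / 3 + 1"
      using real_div_3_bounds(2)[of "K + d"] that by (simp add: field_simps)
    hence "real ((K + d) div 3) / 3 ^ N \<le> (real K / 3 + 1) / 3 ^ N"
      by (rule divide_right_mono) simp
    also have "\<dots> \<le> real K / 3 ^ Suc N + 1" by (simp add: add_divide_distrib)
    finally show ?thesis using Suc.IH[of \<beta> "(K + d) div 3"] by linarith
  qed
  consider "\<alpha> \<le> 1 / 3" | "1 / 3 \<le> \<alpha>" "\<alpha> \<le> 2 / 3" | "2 / 3 \<le> \<alpha>" by linarith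
  then have "\<exists>d\<le>2. \<exists>\<beta>. discrepancy (3 * \<alpha>) ((K + 2) div 3) +
      discrepancy (3 * \<alpha> - 1) ((K + 1) div 3) + discrepancy (3 * \<alpha> - 2) (K div 3) =
      discrepancy \<beta> ((K + d) div 3)"
  proof cases
    case 1
    thus ?thesis
      by (intro exI[of _ 2] conjI exI[of _ "3 * \<alpha>"])
        (simp_all add: discrepancy_nonpos)
  next
    case 2
    thus ?thesis
      by (intro exI[of _ 1] conjI exI[of _ "3 * \<alpha> - 1"])
        (simp_all add: discrepancy_nonpos discrepancy_ge_1)
  next
    case 3
    thus ?thesis
      by (intro exI[of _ 0] conjI exI[of _ "3 * \<alpha> - 2"])
        (simp_all add: discrepancy_ge_1)
  qed
  then obtain d \<beta> where "d \<le> 2" and eq: "discrepancy (3 * \<alpha>) ((K + 2) div 3) +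
      discrepancy (3 * \<alpha> - 1) ((K + 1) div 3) + discrepancy (3 * \<alpha> - 2) (K div 3) =
      discrepancy \<beta> ((K + d) div 3)" by blast
  thus ?case using IH[of d \<beta>] discrepancy_rec[of \<alpha> K] unfolding eq by simp
qed

text \<open>
  For fixed \<open>N\<close> the constant \<open>C N\<close> disappears after division by \<open>n\<close>, so the limit superior of
  \<open>\<bar>E n\<bar> / n\<close> is at most \<open>1 / 3 ^ N\<close>; then \<open>N\<close> is arbitrary.
\<close>

lemma quotient_tendsto_0_if_geometric_slopes:
  fixes E :: "nat \<Rightarrow> real"
  assumes "\<And>N n. \<bar>E n\<bar> \<le> C N + real n / 3 ^ N"
  shows "(\<lambda>n. E n / real n) \<longlonglongrightarrow> 0"
proof (rule LIMSEQ_I)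
  fix r :: real assume "r > 0"
  obtain N where "inverse (3 :: real) ^ N < r / 2"
    using real_arch_pow_inv[of "r / 2" "inverse 3"] \<open>r > 0\<close> by auto
  hence N: "1 / 3 ^ N < r / 2" by (simp add: field_simps)
  obtain n0 :: nat where n0: "2 * C N / r < real n0" using reals_Archimedean2 by blast
  show "\<exists>no. \<forall>n\<ge>no. norm (E n / real n - 0) < r"
  proof (intro exI[of _ "max 1 n0"] allI impI)
    fix n assume n: "max 1 n0 \<le> n"
    hence pos: "real n > 0" by simp
    have "2 * C N / r < real n" using n0 n by linarith
    hence C: "C N < r / 2 * real n" using \<open>r > 0\<close> by (simp add: field_simps)
    have "real n / 3 ^ N < r / 2 * real n"
      using mult_strict_right_mono[OF N pos] by simp
    hence "\<bar>E n\<bar> < r * real n" using assms[of n N] C by linarith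
    thus "norm (E n / real n - 0) < r" using pos by (simp add: field_simps)
  qed
qed

section \<open>Sets cut out by the van der Corput sequence\<close>

definition corput_set :: "real \<Rightarrow> nat set" where
  "corput_set \<alpha> = {n. 1 \<le> n \<and> radical_inverse (n div 3) < \<alpha>}"

text \<open>
  Every value of \<open>n div 3\<close> is taken three times, so the count for \<open>n div 3\<close> up to \<open>n\<close> is the sum of
  three counts for \<open>radical_inverse\<close> up to about \<open>n / 3\<close>, each controlled by the discrepancy.
\<close>

lemma has_asymp_density_corput_set:
  assumes "0 < \<alpha>" "\<alpha> \<le> 1"
  shows "has_asymp_density (corput_set \<alpha>) \<alpha>"
proof -
  define E where "E n = real (card (corput_set \<alpha> \<inter> {1..n})) - \<alpha> * real n" for n
  have "\<bar>E n\<bar> \<le> (9 * real N + 10) + real n / 3 ^ N" for N n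
  proof -
    let ?P = "\<lambda>n. radical_inverse n < \<alpha>"
    define c where "c d = real (count_below ?P ((n + d) div 3))" for d
    \<comment> \<open>\<open>0\<close> satisfies the inequality but is not in the set, whence the \<open>- 1\<close> in the count\<close>
    have "{k. k < Suc n \<and> ?P (k div 3)} = insert 0 (corput_set \<alpha> \<inter> {1..n})"
      using assms by (auto simp: corput_set_def Suc_le_eq)
    moreover have "0 \<notin> corput_set \<alpha> \<inter> {1..n}" by simp
    ultimately have "count_below (\<lambda>k. ?P (k div 3)) (Suc n) =
        Suc (card (corput_set \<alpha> \<inter> {1..n}))"
      by (simp add: count_below_def)
    moreover have "count_below (\<lambda>k. ?P (k div 3)) (Suc n) =
        count_below ?P ((n + 3) div 3) + count_below ?P ((n + 2) div 3) +
        count_below ?P ((n + 1) div 3)"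
    proof -
      have div: "3 * q div 3 = q" "(3 * q + 1) div 3 = q" "(3 * q + 2) div 3 = q" for q :: nat
        by presburger+
      have Suc: "Suc n + 2 = n + 3" "Suc n + 1 = n + 2" "Suc n div 3 = (n + 1) div 3"
        by simp_all
      show ?thesis
        using count_below_split3[of "\<lambda>k. ?P (k div 3)" "Suc n"] unfolding div Suc .
    qed
    ultimately have card: "real (card (corput_set \<alpha> \<inter> {1..n})) = c 3 + c 2 + c 1 - 1"
      unfolding c_def by (simp only: of_nat_add [symmetric] of_nat_Suc)
    have term_bound: "\<bar>c d - \<alpha> * real n / 3\<bar> \<le> 3 * real N + real n / 3 ^ Suc N + 2" if "d \<le> 3" for d
    proof -
      let ?K = "(n + d) div 3"
      have K: "\<bar>real ?K - real n / 3\<bar> \<le> 1" "real ?K \<le> real n / 3 + 1"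
        using real_div_3_bounds[of "n + d"] that by (auto simp: abs_le_iff field_simps)
      have "real ?K / 3 ^ N \<le> (real n / 3 + 1) / 3 ^ N"
        using K(2) by (rule divide_right_mono) simp
      also have "\<dots> \<le> real n / 3 ^ Suc N + 1" by (simp add: add_divide_distrib)
      finally have "\<bar>discrepancy \<alpha> ?K\<bar> \<le> 3 * real N + real n / 3 ^ Suc N + 1"
        using discrepancy_bound[of \<alpha> ?K N] by linarith
      moreover have "\<bar>\<alpha> * (real ?K - real n / 3)\<bar> \<le> 1"
        unfolding abs_mult using assms by (intro mult_le_one K(1)) auto
      moreover have "c d - \<alpha> * real n / 3 =
          discrepancy \<alpha> ?K + \<alpha> * (real ?K - real n / 3)"
        using assms by (simp add: c_def discrepancy_def algebra_simps)
      ultimately show ?thesis by linarith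
    qed
    have sum: "\<bar>x + y + z - 1 - a\<bar> \<le> 3 * b + 1"
      if "\<bar>x - a / 3\<bar> \<le> b" "\<bar>y - a / 3\<bar> \<le> b" "\<bar>z - a / 3\<bar> \<le> b" for a b x y z :: real
      using that by linarith
    have "\<bar>E n\<bar> \<le> 3 * (3 * real N + real n / 3 ^ Suc N + 2) + 1"
      unfolding E_def card by (rule sum; rule term_bound) simp_all
    also have "\<dots> \<le> (9 * real N + 10) + real n / 3 ^ N" by simp
    finally show ?thesis .
  qed
  hence "(\<lambda>n. E n / real n) \<longlonglongrightarrow> 0" by (rule quotient_tendsto_0_if_geometric_slopes)
  hence "(\<lambda>n. E n / real n + \<alpha>) \<longlonglongrightarrow> 0 + \<alpha>" by (intro tendsto_intros)
  moreover have "\<forall>\<^sub>F n in sequentially.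
      E n / real n + \<alpha> = real (card (corput_set \<alpha> \<inter> {1..n})) / real n"
    using eventually_gt_at_top[of 0] by eventually_elim (simp add: E_def field_simps)
  ultimately have "(\<lambda>n. real (card (corput_set \<alpha> \<inter> {1..n})) / real n) \<longlonglongrightarrow> \<alpha>"
    by (simp add: tendsto_cong)
  hence "(\<lambda>n. ereal (real (card (corput_set \<alpha> \<inter> {1..n})) / real n)) \<longlonglongrightarrow> ereal \<alpha>"
    by simp
  thus ?thesis
    unfolding has_asymp_density_def lower_asymp_density_def upper_asymp_density_def
    by (auto intro!: lim_imp_Liminf lim_imp_Limsup)
qed

lemma radical_inverse_locally_less:
  assumes "radical_inverse (n div 3) < \<alpha>"
  obtains N where "\<And>m. [m = n] (mod 3 ^ N) \<Longrightarrow> radical_inverse (m div 3) < \<alpha>"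
proof -
  obtain N where "inverse (3 :: real) ^ N < \<alpha> - radical_inverse (n div 3)"
    using real_arch_pow_inv[of "\<alpha> - radical_inverse (n div 3)" "inverse 3"] assms by auto
  hence N: "1 / 3 ^ N < \<alpha> - radical_inverse (n div 3)" by (simp add: field_simps)
  have "radical_inverse (m div 3) < \<alpha>" if "[m = n] (mod 3 ^ Suc N)" for m
    using radical_inverse_dist[OF cong_power_Suc_digits(2)[OF that]] N by linarith
  thus thesis by (rule that)
qed

lemma union_of_disjoint_arith_progs_corput_set:
  assumes "0 < \<alpha>"
  shows "union_of_disjoint_arith_progs (corput_set \<alpha>)"
proof (rule union_of_disjoint_arith_progs_if_locally_residue_class[of 3])
  have "1 \<in> corput_set \<alpha>" using assms by (simp add: corput_set_def)
  thus "corput_set \<alpha> \<noteq> {}" by blast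
  show "\<exists>N. residue_class (3 ^ N) n \<subseteq> corput_set \<alpha>" if n: "n \<in> corput_set \<alpha>" for n
  proof -
    have "radical_inverse (n div 3) < \<alpha>" using n by (simp add: corput_set_def)
    then obtain N where "\<And>m. [m = n] (mod 3 ^ N) \<Longrightarrow> radical_inverse (m div 3) < \<alpha>"
      using radical_inverse_locally_less by blast
    thus ?thesis by (auto simp: corput_set_def residue_class_def intro!: exI[of _ N])
  qed
qed (auto simp: corput_set_def)

lemma corput_set_contains_two_classes:
  assumes "0 < \<alpha>"
  obtains M where "residue_class (3 ^ M) 0 \<subseteq> corput_set \<alpha>"
    "residue_class (3 ^ M) 1 \<subseteq> corput_set \<alpha>" "M > 0"
proof -
  obtain N0 where N0: "\<And>m. [m = 0] (mod 3 ^ N0) \<Longrightarrow> radical_inverse (m div 3) < \<alpha>"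
    using radical_inverse_locally_less[of 0 \<alpha>] assms by auto
  obtain N1 where N1: "\<And>m. [m = 1] (mod 3 ^ N1) \<Longrightarrow> radical_inverse (m div 3) < \<alpha>"
    using radical_inverse_locally_less[of 1 \<alpha>] assms by auto
  define M where "M = Suc (max N0 N1)"
  have "(3 :: nat) ^ N0 dvd 3 ^ M" "(3 :: nat) ^ N1 dvd 3 ^ M"
    unfolding M_def by (intro le_imp_power_dvd; simp)+
  hence "residue_class (3 ^ M) 0 \<subseteq> corput_set \<alpha>" "residue_class (3 ^ M) 1 \<subseteq> corput_set \<alpha>"
    using N0 N1 by (auto simp: residue_class_def corput_set_def dest: cong_dvd_modulus_nat)
  thus thesis by (rule that) (simp add: M_def)
qed

section \<open>Powers of 2 modulo powers of 3\<close>

text \<open>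
  A primitive root modulo an odd prime \<open>p\<close> stays one modulo all powers of \<open>p\<close> unless its
  \<open>(p - 1)\<close>-st power is \<open>1\<close> modulo \<open>p\<^sup>2\<close>; here that power is \<open>4\<close>, modulo \<open>9\<close>. Modulo \<open>3\<close>
  itself a primitive root exists, and it cannot be \<open>0\<close> or \<open>1\<close>.
\<close>

lemma residue_primroot_2_power_3:
  assumes "M > 0"
  shows "residue_primroot (3 ^ M) 2"
proof -
  have p: "prime (3 :: nat)" by simp
  obtain g :: nat where g: "residue_primroot 3 g" using prime_primitive_root_exists[of 3] p by auto
  have "g mod 3 = 0 \<or> g mod 3 = 1 \<or> g mod 3 = 2" by linarith
  hence "residue_primroot 3 2"
  proof (elim disjE)
    assume "g mod 3 = 0"
    hence "residue_primroot 3 0" using g residue_primroot_mod[of 3 g] by metis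
    thus ?thesis by simp
  next
    assume "g mod 3 = 1"
    hence "residue_primroot 3 (Suc 0)" using g residue_primroot_mod[of 3 g] by (metis One_nat_def)
    thus ?thesis by (simp add: residue_primroot_1_iff)
  next
    assume "g mod 3 = 2"
    thus ?thesis using g residue_primroot_mod[of 3 g] by metis
  qed
  moreover have "[2 ^ (3 - 1) \<noteq> (1 :: nat)] (mod 3\<^sup>2)" by (simp add: cong_def)
  ultimately show ?thesis using residue_primroot_prime_lift_iff[OF p, of 2] assms by simp
qed

text \<open>
  Adding \<open>j + 1\<close> periods to an exponent makes it exceed \<open>j\<close>. The upper bound, uniform in \<open>n\<close>, is what
  makes the exceptional set of the complement below finite.
\<close>

lemma residue_primroot_power_cong:
  assumes "m > 1" "residue_primroot m g" "coprime n m"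
  obtains k where "j < k" "k \<le> totient m * (j + 2)" "[g ^ k = n] (mod m)"
proof -
  have "n mod m \<in> totatives m"
  proof -
    have "coprime (n mod m) m" using assms by (simp add: coprime_mod_left_iff)
    moreover from this have "n mod m \<noteq> 0" using assms(1) by (intro notI) simp
    ultimately show ?thesis using assms(1) by (simp add: totatives_def)
  qed
  also have "totatives m = (\<lambda>i. g ^ i mod m) ` {..<totient m}"
    using bij_betw_imp_surj_on[OF residue_primroot_is_generator[OF assms(1,2)]] by (rule sym)
  finally obtain i where i: "i < totient m" "g ^ i mod m = n mod m"
    by (elim imageE) (simp only: lessThan_iff)
  define k where "k = i + totient m * (j + 1)"
  have "totient m > 0" using assms(1) by simp
  hence "j + 1 \<le> totient m * (j + 1)" by (cases "totient m") auto
  hence "j < k" by (simp add: k_def)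
  moreover have "k \<le> totient m * (j + 2)" using i(1) by (simp add: k_def)
  moreover have "[g ^ k = n] (mod m)"
  proof -
    have "[g ^ totient m = 1] (mod m)"
      using assms(2) by (intro euler_theorem) (auto simp: residue_primroot_def coprime_commute)
    hence "[g ^ i * (g ^ totient m) ^ (j + 1) = n * 1 ^ (j + 1)] (mod m)"
      using i(2) by (intro cong_mult cong_pow) (simp_all add: cong_def)
    thus ?thesis by (simp add: k_def power_add power_mult)
  qed
  ultimately show thesis by (rule that)
qed

text \<open>
  For large \<open>n\<close> take \<open>r = 0\<close> if \<open>3\<close> does not divide \<open>n\<close>, and \<open>r = 1\<close> otherwise. Then \<open>n - r\<close> is
  congruent to a power \<open>2 ^ k\<close> of bounded size, and \<open>n - 2 ^ k\<close> is in the class of \<open>r\<close>.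
\<close>

lemma additive_complement_of_powers_of_2:
  assumes "A \<subseteq> {1..}" "M > 0" "residue_class (3 ^ M) 0 \<subseteq> A" "residue_class (3 ^ M) 1 \<subseteq> A"
  shows "additive_complement A {2 ^ j * 2 ^ k | k. 1 \<le> k}"
proof -
  let ?B = "{2 ^ j * 2 ^ k | k. 1 \<le> k} :: nat set"
  define L :: nat where "L = 2 ^ (totient (3 ^ M) * (j + 2)) + 1"
  have cover: "n \<in> A + ?B"
    if n: "L < n" and r: "\<not> 3 dvd n - r" "residue_class (3 ^ M) r \<subseteq> A" "r \<le> 1" for n r
  proof -
    have "coprime (n - r) (3 ^ M)"
      using r(1) prime_imp_coprime[of 3 "n - r"] by (simp add: coprime_commute)
    moreover have "(1 :: nat) < 3 ^ M" using assms(2) by (intro one_less_power) auto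
    ultimately obtain k where k: "j < k" "k \<le> totient (3 ^ M) * (j + 2)" "[2 ^ k = n - r] (mod 3 ^ M)"
      using residue_primroot_power_cong residue_primroot_2_power_3[OF assms(2)] by metis
    have "(2 :: nat) ^ k \<le> 2 ^ (totient (3 ^ M) * (j + 2))" using k(2) by (intro power_increasing) auto
    hence less: "2 ^ k + 1 < n" using n unfolding L_def by linarith
    have "[2 ^ k + r = (n - r) + r] (mod 3 ^ M)" using k(3) by (rule cong_add) simp
    hence "[2 ^ k + r = 2 ^ k + (n - 2 ^ k)] (mod 3 ^ M)" using less r(3) by simp
    hence "[n - 2 ^ k = r] (mod 3 ^ M)" using cong_add_lcancel_nat cong_sym by blast
    hence "n - 2 ^ k \<in> A" using r(2) less by (auto simp: residue_class_def)
    moreover have "2 ^ k \<in> ?B"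
      using k(1) by (auto intro!: exI[of _ "k - j"] simp flip: power_add)
    ultimately show ?thesis using less by (auto simp: set_plus_def intro!: bexI)
  qed
  have "n \<in> A + ?B" if "L < n" for n
  proof (cases "3 dvd n")
    case True
    hence "\<not> 3 dvd n - 1" using that by presburger
    thus ?thesis using cover[OF that, of 1] assms(4) by simp
  next
    case False
    thus ?thesis using cover[OF that, of 0] assms(3) by simp
  qed
  hence "{1..} - (A + ?B) \<subseteq> {..L}" by (auto simp: not_less[symmetric])
  hence "finite ({1..} - (A + ?B))" by (rule finite_subset) simp
  thus ?thesis using assms(1) by (auto simp: additive_complement_def)
qed

theorem corollary2p1:
  shows "infinite {B :: nat set. infinite_geom_prog B \<and>
    (\<forall>\<alpha>::real. 0 < \<alpha> \<and> \<alpha> \<le> 1 \<longrightarrow>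
      (\<exists>A :: nat set. additive_complement A B \<and> union_of_disjoint_arith_progs A \<and>
        has_asymp_density A \<alpha>))}"
    (is "infinite ?good")
proof -
  define B :: "nat \<Rightarrow> nat set" where "B j = {2 ^ j * 2 ^ k | k. 1 \<le> k}" for j
  have geom: "infinite_geom_prog (B j)" for j
    unfolding infinite_geom_prog_def B_def
    by (intro exI[of _ "2 ^ j"] exI[of _ 2]) simp
  have compl: "additive_complement (corput_set \<alpha>) (B j)" if \<alpha>: "0 < \<alpha>" for \<alpha> j
  proof -
    obtain M where "residue_class (3 ^ M) 0 \<subseteq> corput_set \<alpha>"
      "residue_class (3 ^ M) 1 \<subseteq> corput_set \<alpha>" "M > 0"
      using corput_set_contains_two_classes[OF \<alpha>] .
    moreover have "corput_set \<alpha> \<subseteq> {1..}" by (auto simp: corput_set_def)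
    ultimately show ?thesis unfolding B_def by (intro additive_complement_of_powers_of_2)
  qed
  have "B j \<in> ?good" for j
    using geom compl union_of_disjoint_arith_progs_corput_set has_asymp_density_corput_set
    by blast
  hence "range B \<subseteq> ?good" by blast
  moreover have "inj B"
  proof (rule injI)
    \<comment> \<open>the powers of \<open>2\<close> in \<open>B j\<close> are those with exponent above \<open>j\<close>\<close>
    have mem: "2 ^ (i + 1) \<in> B j \<longleftrightarrow> j \<le> i" for i j
    proof
      assume "2 ^ (i + 1) \<in> B j"
      then obtain k where "(2 :: nat) ^ (i + 1) = 2 ^ (j + k)" "1 \<le> k"
        by (auto simp: B_def power_add)
      thus "j \<le> i" by (simp del: power_Suc)
    next
      assume "j \<le> i"
      thus "2 ^ (i + 1) \<in> B j"
        by (auto simp: B_def intro!: exI[of _ "i + 1 - j"] simp flip: power_add power_Suc)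
    qed
    fix i j assume "B i = B j"
    hence "i \<le> j" "j \<le> i" using mem[of i i] mem[of i j] mem[of j i] mem[of j j] by auto
    thus "i = j" by simp
  qed
  ultimately show ?thesis using infinite_super range_inj_infinite by blast
qed

end
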